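(* Let $(x^*,y^*,z^* )$ be a solution to the KKT system of the problem $\min_{x\in\mathcal X,\,y\in\mathcal Y}\{f(x)+g(y)\mid Ax+By=c\}$, and let $\{(x^k,y^k,z^k)\}$ be the sequence generated by the accelerated semi-proximal ADMM (AsPADMM) described in the context. Then, for all $K=0,1,2,\ldots$, $$-\frac{2C_5\|z^*\|}{1+K(1-\tau)}\le f(x^{K+1})+g(y^{K+1})-f(x^* )-g(y^* )\le\frac{2C_5\|z^*\|+C_6}{1+K(1-\tau)},$$ $$0\le\|c-Ax^{K+1}-By^{K+1}\|\le\frac{2C_5}{1+K(1-\tau)},$$ where $$C_5:=\tfrac2\lambda\|z^0-z^*\|+\|By^0-By^*\|+\tfrac1{\sqrt\lambda}\|x^0-x^*\|_{\mathcal S}+\tfrac1{\sqrt\lambda}\|y^0-y^*\|_{\mathcal T},$$ $$C_6:=\tfrac1{2\lambda}\|z^0-z^*\|^2+\tfrac\lambda2\|By^0-By^*\|^2+\tfrac12\big(\|x^0-x^*\|_{\mathcal S}^2+\|y^0-y^*\|_{\mathcal T}^2\big).$$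
   Context: $\mathcal X,\mathcal Y,\mathcal Z$ are finite-dimensional real Hilbert spaces, each with an inner product $\langle\cdot,\cdot\rangle$ and induced norm $\|\cdot\|$; $f:\mathcal X\to(-\infty,\infty]$ and $g:\mathcal Y\to(-\infty,\infty]$ are closed proper convex functions; $A:\mathcal X\to\mathcal Z$, $B:\mathcal Y\to\mathcal Z$ are linear operators with adjoints $A^*,B^*$; $c\in\mathcal Z$. For a self-adjoint positive semidefinite operator $\mathcal S$, $\|x\|_{\mathcal S}:=\sqrt{\langle x,\mathcal Sx\rangle}$. KKT system: $(x^*,y^*,z^* )$ solves it if $Ax^*+By^*=c$, $0\in\partial f(x^* )-A^*z^*$, $0\in\partial g(y^* )-B^*z^*$. $\Sigma_f:\mathcal X\to\mathcal X$ and $\Sigma_g:\mathcal Y\to\mathcal Y$ are self-adjoint positive semidefinite operators such that for all $x,\hat x\in\mathrm{dom}(f)$, $w\in\partial f(x)$, $\hat w\in\partial f(\hat x)$: $f(x)\ge f(\hat x)+\langle\hat w,x-\hat x\rangle+\frac12\|x-\hat x\|_{\Sigma_f}^2$ and $\langle w-\hat w,x-\hat x\rangle\ge\|x-\hat x\|_{\Sigma_f}^2$; and likewise for $g$ with $\Sigma_g$. Augmented Lagrangian ($\lambda>0$): $\mathcal L_\lambda(x,y,z):=f(x)+g(y)-\langle Ax+By-c,z\rangle+\frac\lambda2\|Ax+By-c\|^2$. AsPADMM: input $x^0\in\mathcal X$, $y^0\in\mathcal Y$, $z^0\in\mathcal Z$, $y^{-1}=y^0$, $\lambda>0$, $\tau\in(0,1)$,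 $\theta^{-1}=1/\tau$ (here the superscript of $\theta$ is an iteration index, not a power), and self-adjoint positive semidefinite linear operators $\mathcal S:\mathcal X\to\mathcal X$, $\mathcal T:\mathcal Y\to\mathcal Y$ such that $\Sigma_f+\mathcal S+\lambda A^*A\succ0$ and $\Sigma_g+\mathcal T+\lambda B^*B\succ0$. For $k=0,1,\ldots$: 1. $\theta^k:=\frac{1}{1-\tau+1/\theta^{k-1}}$, $\ v^k:=y^k+\frac{\theta^k(1-\theta^{k-1})}{\theta^{k-1}}(y^k-y^{k-1})$; 2. $x^{k+1}:=\arg\min_x\ \mathcal L_{\lambda/\theta^k}(x,v^k,z^k)+\frac12\|x-x^k\|_{\mathcal S}^2$; 3. $y^{k+1}:=\arg\min_y\ \mathcal L_{\lambda/\theta^k}(x^{k+1},y,z^k)+\frac12\|y-y^k\|_{\mathcal T}^2$; 4. $z^{k+1}:=z^k-\tau\lambda(Ax^{k+1}+By^{k+1}-c)$.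
   Formalization: In the x-step the additive constant g(v^k) is dropped from the augmented Lagrangian: v^k (e.g. v^0=y^0) may lie outside dom(g), where the literal objective is identically +∞ and every x is a minimizer, so the bounds fail; if g(v^k) is finite the minimizers are the same. *)

theory Defs
  imports "HOL-Analysis.Analysis"
begin

subsection \<open>Extended-real-valued convex functions\<close>

definition eff_domain :: "('a \<Rightarrow> ereal) \<Rightarrow> 'a set" where
  "eff_domain f = {x. f x < \<infinity>}"

definition ereal_epigraph :: "('a \<Rightarrow> ereal) \<Rightarrow> ('a \<times> real) set" where
  "ereal_epigraph f = {(x, t). f x \<le> ereal t}"

definition closed_proper_convex :: "('a::euclidean_space \<Rightarrow> ereal) \<Rightarrow> bool" where
  "closed_proper_convex f \<longleftrightarrow>
     (\<forall>x. f x \<noteq> - \<infinity>) \<and> eff_domain f \<noteq> {} \<and>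
     convex (ereal_epigraph f) \<and> closed (ereal_epigraph f)"

text \<open>For a proper function the subdifferential is empty outside the effective domain.\<close>

definition subdifferential :: "('a::real_inner \<Rightarrow> ereal) \<Rightarrow> 'a \<Rightarrow> 'a set" where
  "subdifferential f x = {w. \<forall>u. f u \<ge> f x + ereal (w \<bullet> (u - x))}"

subsection \<open>Self-adjoint operators\<close>

definition self_adjoint :: "('a::euclidean_space \<Rightarrow> 'a) \<Rightarrow> bool" where
  "self_adjoint S \<longleftrightarrow> linear S \<and> adjoint S = S"

definition psd_operator :: "('a::euclidean_space \<Rightarrow> 'a) \<Rightarrow> bool" where
  "psd_operator S \<longleftrightarrow> self_adjoint S \<and> (\<forall>x. x \<bullet> S x \<ge> 0)"

definition pd_operator :: "('a::euclidean_space \<Rightarrow> 'a) \<Rightarrow> bool" where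
  "pd_operator S \<longleftrightarrow> self_adjoint S \<and> (\<forall>x. x \<noteq> 0 \<longrightarrow> x \<bullet> S x > 0)"

definition op_norm :: "('a::real_inner \<Rightarrow> 'a) \<Rightarrow> 'a \<Rightarrow> real" where
  "op_norm S x = sqrt (x \<bullet> S x)"

definition convexity_operator ::
  "('a::euclidean_space \<Rightarrow> ereal) \<Rightarrow> ('a \<Rightarrow> 'a) \<Rightarrow> bool" where
  "convexity_operator f Sig \<longleftrightarrow>
     psd_operator Sig \<and>
     (\<forall>x \<in> eff_domain f. \<forall>x' \<in> eff_domain f.
        \<forall>w \<in> subdifferential f x. \<forall>w' \<in> subdifferential f x'.
          f x \<ge> f x' + ereal (w' \<bullet> (x - x')) + ereal (1 / 2 * (op_norm Sig (x - x'))\<^sup>2) \<and>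
          (w - w') \<bullet> (x - x') \<ge> (op_norm Sig (x - x'))\<^sup>2)"

subsection \<open>KKT points and the augmented Lagrangian\<close>

definition kkt_solution ::
  "('a::euclidean_space \<Rightarrow> ereal) \<Rightarrow> ('b::euclidean_space \<Rightarrow> ereal) \<Rightarrow>
   ('a \<Rightarrow> 'c::euclidean_space) \<Rightarrow> ('b \<Rightarrow> 'c) \<Rightarrow> 'c \<Rightarrow> 'a \<Rightarrow> 'b \<Rightarrow> 'c \<Rightarrow> bool" where
  "kkt_solution f g A B c x y z \<longleftrightarrow>
     A x + B y = c \<and>
     0 \<in> (\<lambda>w. w - adjoint A z) ` subdifferential f x \<and>
     0 \<in> (\<lambda>w. w - adjoint B z) ` subdifferential g y"

definition aug_lagrangian ::
  "('a::euclidean_space \<Rightarrow> ereal) \<Rightarrow> ('b::euclidean_space \<Rightarrow> ereal) \<Rightarrow>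
   ('a \<Rightarrow> 'c::euclidean_space) \<Rightarrow> ('b \<Rightarrow> 'c) \<Rightarrow> 'c \<Rightarrow> real \<Rightarrow> 'a \<Rightarrow> 'b \<Rightarrow> 'c \<Rightarrow> ereal" where
  "aug_lagrangian f g A B c lam x y z =
     f x + g y - ereal ((A x + B y - c) \<bullet> z) + ereal (lam / 2 * (norm (A x + B y - c))\<^sup>2)"

subsection \<open>The accelerated semi-proximal ADMM\<close>

text \<open>The parameter sequence starts at iteration index $-1$, so it is stored with a shift by one:
  \<open>theta_shifted \<tau> k\<close> is $\theta^{k-1}$, and \<open>theta \<tau> k\<close> is $\theta^k$.\<close>

primrec theta_shifted :: "real \<Rightarrow> nat \<Rightarrow> real" where
  "theta_shifted \<tau> 0 = 1 / \<tau>"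
| "theta_shifted \<tau> (Suc k) = 1 / (1 - \<tau> + 1 / theta_shifted \<tau> k)"

definition theta :: "real \<Rightarrow> nat \<Rightarrow> real" where
  "theta \<tau> k = theta_shifted \<tau> (Suc k)"

text \<open>\<open>previous y k\<close> is $y^{k-1}$, with the convention $y^{-1} = y^0$.\<close>

definition previous :: "(nat \<Rightarrow> 'b) \<Rightarrow> nat \<Rightarrow> 'b" where
  "previous y k = (case k of 0 \<Rightarrow> y 0 | Suc j \<Rightarrow> y j)"

definition extrapolation :: "real \<Rightarrow> (nat \<Rightarrow> 'b::real_vector) \<Rightarrow> nat \<Rightarrow> 'b" where
  "extrapolation \<tau> y k =
     y k + (theta \<tau> k * (1 - theta_shifted \<tau> k) / theta_shifted \<tau> k) *\<^sub>R (y k - previous y k)"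

text \<open>The starting point $(x^0, y^0, z^0)$ is the value of the three sequences at \<open>0\<close> and is
  arbitrary. The first minimisation is over \<open>u\<close> only, and the term $g(v^k)$ of its objective
  is an additive constant. It is left out (\<open>g\<close> is replaced by \<open>\<lambda>_. 0\<close>), because the extrapolated
  point $v^k$ may lie outside the effective domain of \<open>g\<close>: there the objective would be
  identically $\infty$ and every point a minimiser. In the second minimisation the constant
  $f(x^{k+1})$ is finite.\<close>

definition aspadmm ::
  "('a::euclidean_space \<Rightarrow> ereal) \<Rightarrow> ('b::euclidean_space \<Rightarrow> ereal) \<Rightarrow>
   ('a \<Rightarrow> 'c::euclidean_space) \<Rightarrow> ('b \<Rightarrow> 'c) \<Rightarrow> 'c \<Rightarrow> real \<Rightarrow> real \<Rightarrow>
   ('a \<Rightarrow> 'a) \<Rightarrow> ('b \<Rightarrow> 'b) \<Rightarrow>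
   (nat \<Rightarrow> 'a) \<Rightarrow> (nat \<Rightarrow> 'b) \<Rightarrow> (nat \<Rightarrow> 'c) \<Rightarrow> bool" where
  "aspadmm f g A B c lam \<tau> S T x y z \<longleftrightarrow>
     (\<forall>k.
        is_arg_min
          (\<lambda>u. aug_lagrangian f (\<lambda>_. 0) A B c (lam / theta \<tau> k) u (extrapolation \<tau> y k) (z k)
               + ereal (1 / 2 * (op_norm S (u - x k))\<^sup>2))
          (\<lambda>u. u \<in> UNIV) (x (Suc k)) \<and>
        is_arg_min
          (\<lambda>u. aug_lagrangian f g A B c (lam / theta \<tau> k) (x (Suc k)) u (z k)
               + ereal (1 / 2 * (op_norm T (u - y k))\<^sup>2))
          (\<lambda>u. u \<in> UNIV) (y (Suc k)) \<and>
        z (Suc k) = z k - (\<tau> * lam) *\<^sub>R (A (x (Suc k)) + B (y (Suc k)) - c))"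

end

theory Submission
  imports Defs
begin

text \<open>
  Write \<open>t k = 1 / \<theta> k\<close>. The recursion for \<open>\<theta>\<close> says \<open>t k = 1 + k * (1 - \<tau>)\<close>, so the weights
  grow linearly, and this growth is the rate. The proof rests on two extrapolated sequences:
  \<open>y_hat (k + 1) = y k + t k * (y (k + 1) - y k)\<close> and the multiplier
  \<open>z_hat (k + 1) = z k - lam * t k * r (k + 1)\<close>, where \<open>r\<close> is the constraint residual
  \<open>A x + B y - c\<close>. Three facts make them useful.

  Apart from the proximal terms, the subgradients delivered by the two minimisations are those of a
  plain ADMM step with penalty \<open>lam\<close> in the extrapolated variables: the extrapolation coefficient is chosen exactly so that
  \<open>t k * (y (k + 1) - v k) = y_hat (k + 1) - y_hat k\<close>
  (\<open>x_subgradient\<close>, \<open>y_subgradient\<close>).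

  The multiplier update with the short step \<open>\<tau> * lam\<close> makes \<open>z_hat\<close> follow the full-step rule
  \<open>z_hat (k + 1) = z_hat k - lam * (t k * r (k + 1) - (t k - 1) * r k)\<close>, whose bracket is the residual
  of the extrapolated point (\<open>z_hat_Suc\<close>); this uses \<open>t (k + 1) - 1 = t k - \<tau>\<close>.

  Testing each subgradient inequality at the solution with weight 1 and at the previous iterate with
  weight \<open>t k - 1\<close> therefore gives, for the Lagrangian gap \<open>D\<close> at the multiplier \<open>zs\<close> and the
  ADMM energy \<open>E\<close> built from \<open>y_hat\<close>, \<open>z_hat\<close> and the proximal distances of the iterates,
  \<open>t k * D (k + 1) + E (k + 1) \<le> (t k - 1) * D k + E k\<close> (\<open>energy_step\<close>). Since \<open>D \<ge> 0\<close> and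
  \<open>t (k + 1) - 1 \<le> t k\<close>, this telescopes to \<open>t k * D (k + 1) + E (k + 1) \<le> E 0 = C6\<close>.

  For the residual, the energy keeps every \<open>z_hat k\<close> in a fixed ball around \<open>zs\<close>, and each
  \<open>z (k + 1)\<close> is a convex combination of \<open>z k\<close> and \<open>z_hat (k + 1)\<close>, so it stays in that ball too.
  As \<open>lam * t k * r (k + 1) = z k - z_hat (k + 1)\<close>, the weighted residual is bounded
  (\<open>weighted_residual_le\<close>). The objective differs from the Lagrangian gap by \<open>zs \<bullet> r (k + 1)\<close>, which
  the residual bound controls.
\<close>

section \<open>Subgradients from the minimisation steps\<close>

lemma closed_proper_convex_minus_infinity:
  assumes "closed_proper_convex f"
  shows "f x \<noteq> - \<infinity>"
  using assms unfolding closed_proper_convex_def by blast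

lemma closed_proper_convex_finite_somewhere:
  assumes "closed_proper_convex f"
  obtains u r where "f u = ereal r"
proof -
  obtain u where u: "f u < \<infinity>"
    using assms unfolding closed_proper_convex_def eff_domain_def by blast
  then show thesis
    using closed_proper_convex_minus_infinity[OF assms, of u] that by (cases "f u") auto
qed

lemma closed_proper_convex_segment:
  assumes "closed_proper_convex f" "f p = ereal a" "f u = ereal b" "0 \<le> s" "s \<le> 1"
  shows "f (p + s *\<^sub>R (u - p)) \<le> ereal (a + s * (b - a))"
proof -
  have "convex (ereal_epigraph f)"
    using assms(1) unfolding closed_proper_convex_def by blast
  moreover have "(p, a) \<in> ereal_epigraph f" "(u, b) \<in> ereal_epigraph f"
    using assms by (auto simp: ereal_epigraph_def)
  ultimately have "(1 - s) *\<^sub>R (p, a) + s *\<^sub>R (u, b) \<in> ereal_epigraph f"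
    using convexD[of "ereal_epigraph f" "(p, a)" "(u, b)" "1 - s" s] assms(4,5) by simp
  moreover have "(1 - s) *\<^sub>R (p, a) + s *\<^sub>R (u, b) = (p + s *\<^sub>R (u - p), a + s * (b - a))"
    by (auto simp: algebra_simps)
  ultimately show ?thesis by (simp add: ereal_epigraph_def)
qed

lemma subdifferential_nonempty_imp_finite:
  assumes "closed_proper_convex f" "w \<in> subdifferential f p"
  obtains a where "f p = ereal a"
proof -
  obtain u r where "f u = ereal r"
    using closed_proper_convex_finite_somewhere[OF assms(1)] .
  moreover have "f u \<ge> f p + ereal (w \<bullet> (u - p))"
    using assms(2) unfolding subdifferential_def by blast
  ultimately show thesis
    using closed_proper_convex_minus_infinity[OF assms(1), of p] that by (cases "f p") auto
qed

text \<open>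
  Fermat's rule for the sum of a convex function and a quadratic \<open>q\<close> with gradient \<open>d\<close> at \<open>p\<close>.
  Moving from \<open>p\<close> towards \<open>u\<close> by a fraction \<open>s\<close> changes \<open>f\<close> by at most \<open>s\<close> times the difference of
  its values and \<open>q\<close> by its linear part up to order \<open>s\<^sup>2\<close>; dividing by \<open>s\<close> and letting \<open>s\<close> tend to
  0 leaves the subgradient inequality.
\<close>

lemma minimiser_subgradient:
  fixes f :: "'a::euclidean_space \<Rightarrow> ereal"
  assumes f: "closed_proper_convex f"
    and min: "\<And>u. f p + ereal (q p) \<le> f u + ereal (q u)"
    and q: "\<And>h s. q (p + s *\<^sub>R h) = q p + s * (d \<bullet> h) + s\<^sup>2 * Q h"
  shows "- d \<in> subdifferential f p"
proof -
  obtain u0 r0 where "f u0 = ereal r0"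
    using closed_proper_convex_finite_somewhere[OF f] .
  then obtain a where a: "f p = ereal a"
    using min[of u0] closed_proper_convex_minus_infinity[OF f, of p] by (cases "f p") auto
  have "f u \<ge> f p + ereal ((- d) \<bullet> (u - p))" for u
  proof (cases "f u")
    case (real b)
    have bound: "0 \<le> (b - a + d \<bullet> (u - p)) + s * Q (u - p)" if s: "0 < s" "s \<le> 1" for s
    proof -
      have "ereal (a + q p) \<le> f (p + s *\<^sub>R (u - p)) + ereal (q (p + s *\<^sub>R (u - p)))"
        using min[of "p + s *\<^sub>R (u - p)"] a by simp
      also have "\<dots> \<le> ereal (a + s * (b - a)) + ereal (q (p + s *\<^sub>R (u - p)))"
        using closed_proper_convex_segment[OF f a real] s by (intro add_mono) auto
      finally have "a + q p \<le> a + s * (b - a) + q (p + s *\<^sub>R (u - p))" by simp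
      then have "0 \<le> s * ((b - a + d \<bullet> (u - p)) + s * Q (u - p))"
        unfolding q by (simp add: algebra_simps power2_eq_square)
      then show ?thesis using s by (simp add: zero_le_mult_iff)
    qed
    have "((\<lambda>s. (b - a + d \<bullet> (u - p)) + s * Q (u - p)) \<longlongrightarrow> (b - a + d \<bullet> (u - p)) + 0 * Q (u - p))
        (at_right 0)"
      by (intro tendsto_intros)
    moreover have "eventually (\<lambda>s. 0 \<le> (b - a + d \<bullet> (u - p)) + s * Q (u - p)) (at_right (0::real))"
      unfolding eventually_at_right_field using bound by (intro exI[of _ 1]) auto
    ultimately have "0 \<le> (b - a + d \<bullet> (u - p)) + 0 * Q (u - p)"
      by (rule tendsto_lowerbound) simp
    then show ?thesis using a real by simp
  qed (use closed_proper_convex_minus_infinity[OF f, of u] in auto)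
  then show ?thesis by (simp add: subdifferential_def)
qed

lemma op_norm_power2:
  assumes "psd_operator S"
  shows "(op_norm S u)\<^sup>2 = u \<bullet> S u"
  using assms by (simp add: op_norm_def psd_operator_def)

lemma psd_operator_linear: "psd_operator S \<Longrightarrow> linear S"
  by (simp add: psd_operator_def self_adjoint_def)

lemma psd_operator_symmetric:
  assumes "psd_operator S"
  shows "u \<bullet> S v = S u \<bullet> v"
  using assms adjoint_works[of S u v]
  by (simp add: psd_operator_def self_adjoint_def inner_commute)

text \<open>
  Both minimisations of the iteration have this form, with \<open>b\<close> collecting the contribution of the
  block that is held fixed and \<open>c\<close>, and \<open>m\<close> the current penalty parameter.
\<close>

lemma semi_proximal_minimiser_subgradient:
  fixes f :: "'a::euclidean_space \<Rightarrow> ereal" and A :: "'a \<Rightarrow> 'c::euclidean_space"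
  assumes f: "closed_proper_convex f" and A: "linear A" and S: "psd_operator S"
    and min: "\<And>u. f p + ereal (- ((A p + b) \<bullet> z) + m / 2 * (norm (A p + b))\<^sup>2
                    + 1 / 2 * (op_norm S (p - x0))\<^sup>2)
        \<le> f u + ereal (- ((A u + b) \<bullet> z) + m / 2 * (norm (A u + b))\<^sup>2
                    + 1 / 2 * (op_norm S (u - x0))\<^sup>2)"
  shows "adjoint A (z - m *\<^sub>R (A p + b)) - S (p - x0) \<in> subdifferential f p"
proof -
  define q where "q u = - ((A u + b) \<bullet> z) + m / 2 * (norm (A u + b))\<^sup>2
                    + 1 / 2 * (op_norm S (u - x0))\<^sup>2" for u
  define d where "d = S (p - x0) - adjoint A (z - m *\<^sub>R (A p + b))"
  define Q where "Q h = m / 2 * (A h \<bullet> A h) + 1 / 2 * (h \<bullet> S h)" for h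
  have "q (p + s *\<^sub>R h) = q p + s * (d \<bullet> h) + s\<^sup>2 * Q h" for s h
  proof -
    have 1: "A (p + s *\<^sub>R h) + b = (A p + b) + s *\<^sub>R A h"
      using A by (simp add: linear_add linear_scale)
    define e where "e = p - x0"
    have 2: "S (e + s *\<^sub>R h) = S e + s *\<^sub>R S h"
      using psd_operator_linear[OF S] by (simp add: linear_add linear_scale)
    have 3: "e \<bullet> S h = S e \<bullet> h" "h \<bullet> S e = S e \<bullet> h"
      by (rule psd_operator_symmetric[OF S], rule inner_commute)
    have 4: "adjoint A w \<bullet> h = w \<bullet> A h" for w
      using adjoint_works[OF A, of h w] by (simp add: inner_commute)
    have 5: "p + s *\<^sub>R h - x0 = e + s *\<^sub>R h" by (simp add: e_def)
    have "(norm ((A p + b) + s *\<^sub>R A h))\<^sup>2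
        = (norm (A p + b))\<^sup>2 + 2 * s * ((A p + b) \<bullet> A h) + s\<^sup>2 * (A h \<bullet> A h)"
      unfolding power2_norm_eq_inner
      by (simp add: inner_add inner_commute power2_eq_square algebra_simps)
    moreover have "(op_norm S (p + s *\<^sub>R h - x0))\<^sup>2
        = (op_norm S (p - x0))\<^sup>2 + 2 * s * (S (p - x0) \<bullet> h) + s\<^sup>2 * (h \<bullet> S h)"
      unfolding 5 e_def[symmetric] op_norm_power2[OF S] 2
      by (simp add: inner_add 3 power2_eq_square algebra_simps)
    moreover have "d \<bullet> h = S (p - x0) \<bullet> h - z \<bullet> A h + m * ((A p + b) \<bullet> A h)"
      by (simp add: d_def inner_diff_left 4)
    ultimately show ?thesis
      unfolding q_def 1 Q_def
      by (simp only: inner_add_left inner_scaleR_left)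
        (simp add: inner_commute[of z] inner_add_left inner_scaleR_left algebra_simps)
  qed
  then have "- d \<in> subdifferential f p"
    using min by (intro minimiser_subgradient[OF f, where q = q and Q = Q]) (auto simp: q_def)
  then show ?thesis by (simp add: d_def)
qed

text \<open>
  The subgradient inequality at \<open>p\<close> is added up with weight 1 at \<open>us\<close> and weight \<open>t - 1\<close> at \<open>u0\<close>;
  the two displacements combine to the extrapolated point. For \<open>t = 1\<close> the value at \<open>u0\<close> has weight
  0 and \<open>e\<close> is arbitrary. This matters for the first iteration, whose starting point may lie outside
  the effective domain.
\<close>

lemma subgradient_weighted_bound:
  fixes f :: "'a::real_inner \<Rightarrow> ereal"
  assumes w: "w \<in> subdifferential f p" and t: "1 \<le> t"
    and fp: "f p = ereal a" and fs: "f us = ereal b" and f0: "1 < t \<Longrightarrow> f u0 = ereal e"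
  shows "t * a - (t - 1) * e - b \<le> w \<bullet> (u0 + t *\<^sub>R (p - u0) - us)"
proof -
  have sub: "f u \<ge> f p + ereal (w \<bullet> (u - p))" for u
    using w by (simp add: subdifferential_def)
  have us: "b \<ge> a + w \<bullet> (us - p)"
    using sub[of us] fp fs by simp
  have u0: "(t - 1) * e \<ge> (t - 1) * (a + w \<bullet> (u0 - p))"
  proof (cases "t = 1")
    case False
    then have "e \<ge> a + w \<bullet> (u0 - p)"
      using sub[of u0] fp f0 t by simp
    then show ?thesis using t by (intro mult_left_mono) auto
  qed simp
  have "w \<bullet> (u0 + t *\<^sub>R (p - u0) - us) = - (w \<bullet> (us - p)) - (t - 1) * (w \<bullet> (u0 - p))"
    by (simp add: inner_diff_right inner_add_right algebra_simps)
  then show ?thesis using us u0 by (simp add: algebra_simps)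
qed

section \<open>One step of the energy estimate\<close>

lemma inner_three_point:
  fixes a b s :: "'a::real_inner"
  shows "2 * ((a - b) \<bullet> (a - s)) = (norm (a - s))\<^sup>2 - (norm (b - s))\<^sup>2 + (norm (a - b))\<^sup>2"
  unfolding power2_norm_eq_inner by (simp add: inner_diff inner_commute algebra_simps)

text \<open>
  Along the extrapolated point the proximal term still telescopes in the unextrapolated iterates:
  with \<open>d = u1 - u0\<close> the inner product on the right is \<open>S d \<bullet> (u0 - us) + t * (S d \<bullet> d)\<close>, while half
  the left-hand side is \<open>S d \<bullet> (u0 - us) + 1 / 2 * (S d \<bullet> d)\<close>.
\<close>

lemma psd_extrapolated_three_point:
  assumes S: "psd_operator S" and t: "1 \<le> t"
  shows "(op_norm S (u1 - us))\<^sup>2 - (op_norm S (u0 - us))\<^sup>2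
      \<le> 2 * (S (u1 - u0) \<bullet> (u0 + t *\<^sub>R (u1 - u0) - us))"
proof -
  define d e where "d = u1 - u0" and "e = u0 - us"
  have u1: "u1 - us = e + d" by (simp add: d_def e_def)
  have nn: "0 \<le> d \<bullet> S d" using S by (simp add: psd_operator_def)
  have sym: "e \<bullet> S d = d \<bullet> S e"
    using psd_operator_symmetric[OF S, of e d] by (simp add: inner_commute)
  have "(op_norm S (u1 - us))\<^sup>2 = e \<bullet> S e + 2 * (d \<bullet> S e) + d \<bullet> S d"
    unfolding op_norm_power2[OF S] u1
    using sym psd_operator_linear[OF S] by (simp add: linear_add inner_add)
  moreover have "S (u1 - u0) \<bullet> (u0 + t *\<^sub>R (u1 - u0) - us) = d \<bullet> S e + t * (d \<bullet> S d)"
  proof -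
    have eq: "u0 + t *\<^sub>R (u1 - u0) - us = e + t *\<^sub>R d" by (simp add: d_def e_def)
    show ?thesis
      unfolding eq unfolding d_def[symmetric]
      by (simp add: inner_add_right inner_commute[of "S d"] sym)
  qed
  moreover have "(op_norm S (u0 - us))\<^sup>2 = e \<bullet> S e"
    by (simp add: op_norm_power2[OF S] e_def)
  moreover have "1 * (d \<bullet> S d) \<le> t * (d \<bullet> S d)"
    using nn t by (intro mult_right_mono) auto
  ultimately show ?thesis using nn by linarith
qed

text \<open>
  The heart of the ADMM estimate. Here \<open>a\<close> stands for \<open>A (x - xs)\<close> and \<open>b0\<close>, \<open>b1\<close> for \<open>B (y - ys)\<close>
  before and after the step, so \<open>r = a + b1\<close> is the residual. Two three-point identities turn the
  left-hand side into the right-hand side minus the square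
  \<open>lam / 2 * (norm (r - (b1 - b0)))\<^sup>2\<close>.
\<close>

lemma admm_multiplier_estimate:
  fixes zh zh1 zs :: "'c::real_inner"
  assumes lam: "0 < lam"
    and zh1: "zh1 = zh - lam *\<^sub>R (a + b1)"
  shows "(zh1 - zs) \<bullet> (a + b1) + lam * ((b1 - b0) \<bullet> a)
      \<le> 1 / (2 * lam) * ((norm (zh - zs))\<^sup>2 - (norm (zh1 - zs))\<^sup>2)
        + lam / 2 * ((norm b0)\<^sup>2 - (norm b1)\<^sup>2)"
proof -
  define r where "r = a + b1"
  have r: "zh1 - zh = - lam *\<^sub>R r" using zh1 by (simp add: r_def)
  have "2 * ((zh1 - zh) \<bullet> (zh1 - zs)) = (norm (zh1 - zs))\<^sup>2 - (norm (zh - zs))\<^sup>2 + (norm (zh1 - zh))\<^sup>2"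
    by (rule inner_three_point)
  then have 1: "1 / (2 * lam) * ((norm (zh - zs))\<^sup>2 - (norm (zh1 - zs))\<^sup>2)
      = (zh1 - zs) \<bullet> r + lam / 2 * (norm r)\<^sup>2"
    using lam unfolding r by (simp add: field_simps inner_commute power2_eq_square)
  have "2 * ((b1 - b0) \<bullet> (b1 - 0)) = (norm (b1 - 0))\<^sup>2 - (norm (b0 - 0))\<^sup>2 + (norm (b1 - b0))\<^sup>2"
    by (rule inner_three_point)
  then have "(norm b0)\<^sup>2 - (norm b1)\<^sup>2 = (norm (b1 - b0))\<^sup>2 - 2 * ((b1 - b0) \<bullet> b1)"
    by simp
  then have 2: "lam / 2 * ((norm b0)\<^sup>2 - (norm b1)\<^sup>2)
      = lam / 2 * (norm (b1 - b0))\<^sup>2 - lam * ((b1 - b0) \<bullet> b1)"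
    by (simp only:) (simp add: right_diff_distrib)
  have "(norm (r - (b1 - b0)))\<^sup>2 = (norm r)\<^sup>2 - 2 * ((b1 - b0) \<bullet> r) + (norm (b1 - b0))\<^sup>2"
    unfolding power2_norm_eq_inner by (simp add: inner_diff inner_commute algebra_simps)
  then have "lam / 2 * (norm (r - (b1 - b0)))\<^sup>2
      = lam / 2 * (norm r)\<^sup>2 - lam * ((b1 - b0) \<bullet> r) + lam / 2 * (norm (b1 - b0))\<^sup>2"
    by (simp only:) (simp add: right_diff_distrib distrib_left)
  moreover have "0 \<le> lam / 2 * (norm (r - (b1 - b0)))\<^sup>2" using lam by simp
  moreover have "lam * ((b1 - b0) \<bullet> a) = lam * ((b1 - b0) \<bullet> r) - lam * ((b1 - b0) \<bullet> b1)"
    by (simp add: r_def inner_add_right algebra_simps)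
  ultimately show ?thesis using 1 2 unfolding r_def[symmetric] by linarith
qed

section \<open>The accelerated iteration\<close>

lemma theta_shifted_eq: "theta_shifted \<tau> k = 1 / (\<tau> + real k * (1 - \<tau>))"
proof (induction k)
  case (Suc k)
  then show ?case by (simp add: algebra_simps)
qed simp

locale aspadmm_run =
  fixes f :: "'a::euclidean_space \<Rightarrow> ereal" and g :: "'b::euclidean_space \<Rightarrow> ereal"
    and A :: "'a \<Rightarrow> 'c::euclidean_space" and B :: "'b \<Rightarrow> 'c" and c :: 'c
    and lam \<tau> :: real and S :: "'a \<Rightarrow> 'a" and T :: "'b \<Rightarrow> 'b"
    and x :: "nat \<Rightarrow> 'a" and y :: "nat \<Rightarrow> 'b" and z :: "nat \<Rightarrow> 'c"
    and xs :: 'a and ys :: 'b and zs :: 'c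
  assumes f: "closed_proper_convex f" and g: "closed_proper_convex g"
    and A: "linear A" and B: "linear B"
    and lam: "0 < lam" and \<tau>: "0 < \<tau>" "\<tau> < 1"
    and S: "psd_operator S" and T: "psd_operator T"
    and kkt: "kkt_solution f g A B c xs ys zs"
    and iter: "aspadmm f g A B c lam \<tau> S T x y z"
begin

definition weight :: "nat \<Rightarrow> real" where
  "weight k = 1 + real k * (1 - \<tau>)"

definition residual :: "nat \<Rightarrow> 'c" where
  "residual k = A (x k) + B (y k) - c"

text \<open>
  At index 0 both hatted sequences are the starting values. Since \<open>weight 0 = 1\<close>, also
  \<open>y_hat 1 = y 1\<close>: there is no extrapolation in the first iteration.
\<close>

definition y_hat :: "nat \<Rightarrow> 'b" where
  "y_hat k = (case k of 0 \<Rightarrow> y 0 | Suc j \<Rightarrow> y j + weight j *\<^sub>R (y (Suc j) - y j))"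

definition z_hat :: "nat \<Rightarrow> 'c" where
  "z_hat k = (case k of 0 \<Rightarrow> z 0 | Suc j \<Rightarrow> z j - (lam * weight j) *\<^sub>R residual (Suc j))"

text \<open>
  The values at \<open>xs\<close>, \<open>ys\<close> and at all iterates from index 1 on are finite, so the passage to the
  reals is faithful there. At index 0 they may be infinite; then the real value is a dummy, which
  enters only with the weight \<open>weight 0 - 1 = 0\<close>.
\<close>

definition objective_gap :: "nat \<Rightarrow> real" where
  "objective_gap k = real_of_ereal (f (x k)) + real_of_ereal (g (y k))
     - real_of_ereal (f xs) - real_of_ereal (g ys)"

definition lagrangian_gap :: "nat \<Rightarrow> real" where
  "lagrangian_gap k = objective_gap k - zs \<bullet> residual k"

definition energy :: "nat \<Rightarrow> real" where
  "energy k = 1 / (2 * lam) * (norm (z_hat k - zs))\<^sup>2 + lam / 2 * (norm (B (y_hat k) - B ys))\<^sup>2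
     + 1 / 2 * ((op_norm S (x k - xs))\<^sup>2 + (op_norm T (y k - ys))\<^sup>2)"

lemma weight_ge_1: "1 \<le> weight k"
  using \<tau> by (simp add: weight_def)

lemma weight_0 [simp]: "weight 0 = 1"
  by (simp add: weight_def)

lemma weight_Suc: "weight (Suc k) = weight k + 1 - \<tau>"
  by (simp add: weight_def algebra_simps)

lemma theta_eq: "theta \<tau> k = 1 / weight k"
  unfolding theta_def theta_shifted_eq by (simp add: weight_def algebra_simps)

lemma theta_shifted_Suc_eq: "theta_shifted \<tau> (Suc k) = 1 / weight k"
  using theta_eq by (simp add: theta_def)

lemma lam_over_theta: "lam / theta \<tau> k = lam * weight k"
  by (simp add: theta_eq)

text \<open>
  This identity explains the extrapolation coefficient of the algorithm, which in terms of the
  weights is \<open>(weight (k - 1) - 1) / weight k\<close>.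
\<close>

lemma weight_scaled_extrapolation:
  "weight k *\<^sub>R (y (Suc k) - extrapolation \<tau> y k) = y_hat (Suc k) - y_hat k"
proof (cases k)
  case 0
  then show ?thesis by (simp add: y_hat_def extrapolation_def previous_def)
next
  case (Suc j)
  have "weight k * (theta \<tau> k * (1 - theta_shifted \<tau> k) / theta_shifted \<tau> k) = weight j - 1"
    unfolding theta_eq Suc theta_shifted_Suc_eq
    using weight_ge_1[of j] weight_ge_1[of "Suc j"] by (simp add: field_simps)
  then have "weight k *\<^sub>R (y (Suc k) - extrapolation \<tau> y k)
      = weight k *\<^sub>R (y (Suc k) - y k) - (weight j - 1) *\<^sub>R (y k - y j)"
    by (simp add: extrapolation_def previous_def Suc scaleR_diff_right scaleR_add_right)
  also have "\<dots> = y_hat (Suc k) - y_hat k"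
    by (simp add: y_hat_def Suc algebra_simps)
  finally show ?thesis .
qed

text \<open>
  The actual update of \<open>z\<close> subtracts \<open>\<tau> * lam\<close> times the residual, and the increment of the
  extrapolated multiplier combines it with the change of the weight:
  \<open>weight j - \<tau> = weight (j + 1) - 1\<close>.
\<close>

lemma z_hat_Suc:
  "z_hat (Suc k) = z_hat k - lam *\<^sub>R (weight k *\<^sub>R residual (Suc k) - (weight k - 1) *\<^sub>R residual k)"
proof (cases k)
  case 0
  then show ?thesis by (simp add: z_hat_def)
next
  case (Suc j)
  have "z (Suc j) = z j - (\<tau> * lam) *\<^sub>R residual (Suc j)"
    using iter by (simp add: aspadmm_def residual_def)
  then show ?thesis
    by (simp add: z_hat_def Suc weight_Suc algebra_simps)
qed

lemma z_Suc_convex_combination: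
  "z (Suc k) = (1 - \<tau> / weight k) *\<^sub>R z k + (\<tau> / weight k) *\<^sub>R z_hat (Suc k)"
proof -
  have "z (Suc k) = z k - (\<tau> * lam) *\<^sub>R residual (Suc k)"
    using iter by (simp add: aspadmm_def residual_def)
  moreover have "(\<tau> / weight k) * (lam * weight k) = \<tau> * lam"
    using weight_ge_1[of k] by simp
  ultimately show ?thesis
    by (simp add: z_hat_def scaleR_diff_right scaleR_diff_left)
qed

text \<open>
  The first minimisation uses \<open>v\<close> instead of the new \<open>y\<close>, and with penalty \<open>lam * weight k\<close> this
  adds \<open>lam\<close> times the increment of \<open>B y_hat\<close> to the multiplier \<open>z_hat (k + 1)\<close>.
\<close>

lemma x_subgradient:
  "adjoint A (z_hat (Suc k) + lam *\<^sub>R (B (y_hat (Suc k)) - B (y_hat k))) - S (x (Suc k) - x k)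
     \<in> subdifferential f (x (Suc k))"
proof -
  define v where "v = extrapolation \<tau> y k"
  have eq: "aug_lagrangian f (\<lambda>_. 0) A B c (lam / theta \<tau> k) u v (z k)
          + ereal (1 / 2 * (op_norm S (u - x k))\<^sup>2)
      = f u + ereal (- ((A u + (B v - c)) \<bullet> z k) + lam * weight k / 2 * (norm (A u + (B v - c)))\<^sup>2
          + 1 / 2 * (op_norm S (u - x k))\<^sup>2)" for u
    unfolding aug_lagrangian_def lam_over_theta by (cases "f u") (auto simp: algebra_simps)
  have "adjoint A (z k - (lam * weight k) *\<^sub>R (A (x (Suc k)) + (B v - c))) - S (x (Suc k) - x k)
      \<in> subdifferential f (x (Suc k))"
    by (rule semi_proximal_minimiser_subgradient[OF f A S], unfold eq[symmetric])
      (use iter in \<open>simp add: aspadmm_def is_arg_min_def v_def not_less\<close>)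
  moreover have "z k - (lam * weight k) *\<^sub>R (A (x (Suc k)) + (B v - c))
      = z_hat (Suc k) + lam *\<^sub>R (B (y_hat (Suc k)) - B (y_hat k))"
  proof -
    have "B (y_hat (Suc k)) - B (y_hat k) = weight k *\<^sub>R (B (y (Suc k)) - B v)"
      using weight_scaled_extrapolation[of k] B unfolding v_def
      by (metis linear_diff linear_scale)
    then have "lam *\<^sub>R (B (y_hat (Suc k)) - B (y_hat k)) = (lam * weight k) *\<^sub>R (B (y (Suc k)) - B v)"
      by simp
    then show ?thesis
      unfolding \<open>lam *\<^sub>R (B (y_hat (Suc k)) - B (y_hat k)) = _\<close>
      by (simp add: z_hat_def residual_def algebra_simps)
  qed
  ultimately show ?thesis by simp
qed

lemma f_x_Suc_finite: "f (x (Suc k)) = ereal (real_of_ereal (f (x (Suc k))))"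
  using subdifferential_nonempty_imp_finite[OF f x_subgradient[of k]] by (metis real_of_ereal.simps(1))

lemma y_subgradient:
  "adjoint B (z_hat (Suc k)) - T (y (Suc k) - y k) \<in> subdifferential g (y (Suc k))"
proof -
  define a where "a = real_of_ereal (f (x (Suc k)))"
  have a: "f (x (Suc k)) = ereal a" using f_x_Suc_finite by (simp add: a_def)
  define b where "b = A (x (Suc k)) - c"
  \<comment> \<open>The constant \<open>f (x (Suc k))\<close> is finite and can be cancelled from the objective.\<close>
  have eq: "aug_lagrangian f g A B c (lam / theta \<tau> k) (x (Suc k)) u (z k)
          + ereal (1 / 2 * (op_norm T (u - y k))\<^sup>2)
      = ereal a + (g u + ereal (- ((B u + b) \<bullet> z k) + lam * weight k / 2 * (norm (B u + b))\<^sup>2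
          + 1 / 2 * (op_norm T (u - y k))\<^sup>2))" for u
    unfolding aug_lagrangian_def lam_over_theta a b_def
    by (cases "g u") (auto simp: algebra_simps)
  have "adjoint B (z k - (lam * weight k) *\<^sub>R (B (y (Suc k)) + b)) - T (y (Suc k) - y k)
      \<in> subdifferential g (y (Suc k))"
  proof (rule semi_proximal_minimiser_subgradient[OF g B T])
    fix u
    have "\<not> (ereal a + (g u + ereal (- ((B u + b) \<bullet> z k) + lam * weight k / 2 * (norm (B u + b))\<^sup>2
          + 1 / 2 * (op_norm T (u - y k))\<^sup>2))
        < ereal a + (g (y (Suc k)) + ereal (- ((B (y (Suc k)) + b) \<bullet> z k)
          + lam * weight k / 2 * (norm (B (y (Suc k)) + b))\<^sup>2
          + 1 / 2 * (op_norm T (y (Suc k) - y k))\<^sup>2)))"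
      using iter unfolding aspadmm_def is_arg_min_def eq[symmetric] by blast
    then show "g (y (Suc k)) + ereal (- ((B (y (Suc k)) + b) \<bullet> z k)
          + lam * weight k / 2 * (norm (B (y (Suc k)) + b))\<^sup>2
          + 1 / 2 * (op_norm T (y (Suc k) - y k))\<^sup>2)
        \<le> g u + ereal (- ((B u + b) \<bullet> z k) + lam * weight k / 2 * (norm (B u + b))\<^sup>2
          + 1 / 2 * (op_norm T (u - y k))\<^sup>2)"
      by (metis ereal_less_add linorder_not_le abs_ereal.simps(1) PInfty_neq_ereal(1))
  qed
  moreover have "z k - (lam * weight k) *\<^sub>R (B (y (Suc k)) + b) = z_hat (Suc k)"
    by (simp add: z_hat_def residual_def b_def algebra_simps)
  ultimately show ?thesis by simp
qed

lemma g_y_Suc_finite: "g (y (Suc k)) = ereal (real_of_ereal (g (y (Suc k))))"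
  using subdifferential_nonempty_imp_finite[OF g y_subgradient[of k]] by (metis real_of_ereal.simps(1))

lemma kkt_subgradients: "adjoint A zs \<in> subdifferential f xs" "adjoint B zs \<in> subdifferential g ys"
  using kkt by (auto simp: kkt_solution_def)

lemma kkt_feasible: "A xs + B ys = c"
  using kkt by (simp add: kkt_solution_def)

lemma f_xs_finite: "f xs = ereal (real_of_ereal (f xs))"
  using subdifferential_nonempty_imp_finite[OF f kkt_subgradients(1)] by (metis real_of_ereal.simps(1))

lemma g_ys_finite: "g ys = ereal (real_of_ereal (g ys))"
  using subdifferential_nonempty_imp_finite[OF g kkt_subgradients(2)] by (metis real_of_ereal.simps(1))

lemma adjoint_inner: "adjoint A w \<bullet> u = w \<bullet> A u" "adjoint B w \<bullet> v = w \<bullet> B v"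
  using adjoint_works[OF A, of u w] adjoint_works[OF B, of v w] by (simp_all add: inner_commute)

text \<open>
  A solution of the KKT system minimises the Lagrangian at its multiplier.
\<close>

lemma lagrangian_gap_Suc_nonneg: "0 \<le> lagrangian_gap (Suc k)"
proof -
  have "f (x (Suc k)) \<ge> f xs + ereal (adjoint A zs \<bullet> (x (Suc k) - xs))"
    "g (y (Suc k)) \<ge> g ys + ereal (adjoint B zs \<bullet> (y (Suc k) - ys))"
    using kkt_subgradients by (auto simp: subdifferential_def)
  then have "real_of_ereal (f (x (Suc k))) \<ge> real_of_ereal (f xs) + zs \<bullet> (A (x (Suc k)) - A xs)"
    "real_of_ereal (g (y (Suc k))) \<ge> real_of_ereal (g ys) + zs \<bullet> (B (y (Suc k)) - B ys)"
    unfolding adjoint_inner linear_diff[OF A] linear_diff[OF B]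
    by (metis f_x_Suc_finite f_xs_finite ereal_less_eq(3) plus_ereal.simps(1),
        metis g_y_Suc_finite g_ys_finite ereal_less_eq(3) plus_ereal.simps(1))
  moreover have "zs \<bullet> residual (Suc k) = zs \<bullet> (A (x (Suc k)) - A xs) + zs \<bullet> (B (y (Suc k)) - B ys)"
    unfolding residual_def unfolding kkt_feasible[symmetric]
    by (simp add: inner_diff_right inner_add_right)
  ultimately show ?thesis
    by (simp add: lagrangian_gap_def objective_gap_def)
qed

section \<open>Energy decay and the convergence rate\<close>

text \<open>
  The subgradient bounds \<open>A'\<close> and \<open>B'\<close> are added, and the terms containing \<open>a\<close> and \<open>b1\<close> are collected
  into the left-hand side of \<open>admm_multiplier_estimate\<close>. The residual of the extrapolated point is a
  combination of consecutive residuals because the constraint is affine, so the Lagrangian gap picks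
  up the same weights as the objective.
\<close>

lemma energy_step:
  "weight k * lagrangian_gap (Suc k) + energy (Suc k) \<le> (weight k - 1) * lagrangian_gap k + energy k"
proof -
  define t where "t = weight k"
  define xh where "xh = x k + t *\<^sub>R (x (Suc k) - x k)"
  define yh where "yh = y k + t *\<^sub>R (y (Suc k) - y k)"
  define zh where "zh = z_hat (Suc k)"
  define b1 b0 where "b1 = B (y_hat (Suc k)) - B ys" and "b0 = B (y_hat k) - B ys"
  define a where "a = A xh - A xs"
  define P where "P = 1 / (2 * lam) * ((norm (z_hat k - zs))\<^sup>2 - (norm (zh - zs))\<^sup>2)
        + lam / 2 * ((norm b0)\<^sup>2 - (norm b1)\<^sup>2)"
  have t: "1 \<le> t" using weight_ge_1 by (simp add: t_def)
  have yh: "yh = y_hat (Suc k)" by (simp add: yh_def y_hat_def t_def)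
  have fin: "\<exists>j. k = Suc j" if "1 < t" using that by (cases k) (auto simp: t_def)
  have fk: "f (x k) = ereal (real_of_ereal (f (x k)))" "g (y k) = ereal (real_of_ereal (g (y k)))"
    if "1 < t" using fin[OF that] f_x_Suc_finite g_y_Suc_finite by auto
  have A': "t * real_of_ereal (f (x (Suc k))) - (t - 1) * real_of_ereal (f (x k)) - real_of_ereal (f xs)
      \<le> (zh + lam *\<^sub>R (b1 - b0)) \<bullet> a - S (x (Suc k) - x k) \<bullet> (xh - xs)"
    using subgradient_weighted_bound[OF x_subgradient[of k] t f_x_Suc_finite f_xs_finite fk(1)]
    by (simp add: xh_def[symmetric] inner_diff_left adjoint_inner zh_def b1_def b0_def a_def
        linear_diff[OF A])
  have B': "t * real_of_ereal (g (y (Suc k))) - (t - 1) * real_of_ereal (g (y k)) - real_of_ereal (g ys)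
      \<le> zh \<bullet> b1 - T (y (Suc k) - y k) \<bullet> (yh - ys)"
    using subgradient_weighted_bound[OF y_subgradient[of k] t g_y_Suc_finite g_ys_finite fk(2)]
    unfolding yh_def[symmetric] inner_diff_left adjoint_inner linear_diff[OF B] b1_def yh[symmetric]
      zh_def by simp
  have res: "a + b1 = t *\<^sub>R residual (Suc k) - (t - 1) *\<^sub>R residual k"
  proof -
    have "a + b1 = A xh + B yh - c" using kkt_feasible by (simp add: a_def b1_def yh algebra_simps)
    also have "\<dots> = t *\<^sub>R residual (Suc k) - (t - 1) *\<^sub>R residual k"
      by (simp add: xh_def yh_def residual_def linear_add[OF A] linear_add[OF B] linear_diff[OF A]
          linear_diff[OF B] linear_scale[OF A] linear_scale[OF B] algebra_simps)
    finally show ?thesis .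
  qed
  have "zh = z_hat k - lam *\<^sub>R (a + b1)"
    using z_hat_Suc[of k] by (simp add: res zh_def t_def)
  from admm_multiplier_estimate[OF lam this, of zs b0]
  have main: "(zh - zs) \<bullet> (a + b1) + lam * ((b1 - b0) \<bullet> a) \<le> P"
    unfolding P_def .
  have "t * lagrangian_gap (Suc k) - (t - 1) * lagrangian_gap k
      = (t * real_of_ereal (f (x (Suc k))) - (t - 1) * real_of_ereal (f (x k)) - real_of_ereal (f xs))
      + (t * real_of_ereal (g (y (Suc k))) - (t - 1) * real_of_ereal (g (y k)) - real_of_ereal (g ys))
      - zs \<bullet> (a + b1)"
    unfolding res by (simp add: lagrangian_gap_def objective_gap_def inner_diff_right algebra_simps)
  also have "\<dots> \<le> ((zh + lam *\<^sub>R (b1 - b0)) \<bullet> a - S (x (Suc k) - x k) \<bullet> (xh - xs))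
      + (zh \<bullet> b1 - T (y (Suc k) - y k) \<bullet> (yh - ys)) - zs \<bullet> (a + b1)"
    by (intro diff_right_mono add_mono A' B')
  also have "\<dots> = ((zh - zs) \<bullet> (a + b1) + lam * ((b1 - b0) \<bullet> a))
      - S (x (Suc k) - x k) \<bullet> (xh - xs) - T (y (Suc k) - y k) \<bullet> (yh - ys)"
    by (simp add: inner_add inner_diff_left algebra_simps)
  also have "\<dots> \<le> P - S (x (Suc k) - x k) \<bullet> (xh - xs) - T (y (Suc k) - y k) \<bullet> (yh - ys)"
    using main by (intro diff_right_mono)
  also have "\<dots> \<le> P - 1 / 2 * ((op_norm S (x (Suc k) - xs))\<^sup>2 - (op_norm S (x k - xs))\<^sup>2)
        - 1 / 2 * ((op_norm T (y (Suc k) - ys))\<^sup>2 - (op_norm T (y k - ys))\<^sup>2)"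
    using psd_extrapolated_three_point[OF S t, of "x (Suc k)" xs "x k"]
      psd_extrapolated_three_point[OF T t, of "y (Suc k)" ys "y k"]
    unfolding xh_def[symmetric] yh_def[symmetric] by (intro diff_mono) auto
  also have "\<dots> = energy k - energy (Suc k)"
    by (simp add: energy_def P_def zh_def b0_def b1_def algebra_simps)
  finally have "t * lagrangian_gap (Suc k) - (t - 1) * lagrangian_gap k
      \<le> energy k - energy (Suc k)" .
  then show ?thesis by (simp add: t_def)
qed

text \<open>
  The step estimates nearly telescope: \<open>weight (k + 1) - 1\<close> falls short of \<open>weight k\<close> by \<open>\<tau>\<close>, and the
  gap that it multiplies is nonnegative.
\<close>

lemma energy_bound: "weight k * lagrangian_gap (Suc k) + energy (Suc k) \<le> energy 0"
proof (induction k)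
  case 0
  then show ?case using energy_step[of 0] by simp
next
  case (Suc k)
  have "(weight (Suc k) - 1) * lagrangian_gap (Suc k) \<le> weight k * lagrangian_gap (Suc k)"
    using lagrangian_gap_Suc_nonneg[of k] \<tau> by (intro mult_right_mono) (auto simp: weight_Suc)
  then show ?case using Suc energy_step[of "Suc k"] by linarith
qed

lemma energy_0:
  "energy 0 = 1 / (2 * lam) * (norm (z 0 - zs))\<^sup>2 + lam / 2 * (norm (B (y 0) - B ys))\<^sup>2
     + 1 / 2 * ((op_norm S (x 0 - xs))\<^sup>2 + (op_norm T (y 0 - ys))\<^sup>2)"
  by (simp add: energy_def z_hat_def y_hat_def)

lemma z_hat_dist_le: "norm (z_hat k - zs) \<le> sqrt (2 * lam * energy 0)"
proof -
  have le: "energy k \<le> energy 0"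
  proof (cases k)
    case (Suc j)
    have "0 \<le> weight j * lagrangian_gap (Suc j)"
      using lagrangian_gap_Suc_nonneg weight_ge_1[of j] by simp
    then show ?thesis using energy_bound[of j] Suc by simp
  qed simp
  have "1 / (2 * lam) * (norm (z_hat k - zs))\<^sup>2 \<le> energy k"
    using lam by (simp add: energy_def)
  then have "(norm (z_hat k - zs))\<^sup>2 \<le> 2 * lam * energy k"
    using lam by (simp add: divide_le_eq mult.commute mult.left_commute)
  also have "\<dots> \<le> 2 * lam * energy 0"
    using le lam by simp
  finally have "(norm (z_hat k - zs))\<^sup>2 \<le> 2 * lam * energy 0" .
  then show ?thesis by (rule real_le_rsqrt)
qed

text \<open>
  Each \<open>z\<close> is obtained from the previous one by moving a fraction \<open>\<tau> / weight k\<close> towards \<open>z_hat\<close>, so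
  it inherits the bound by convexity of the ball.
\<close>

lemma z_dist_le: "norm (z k - zs) \<le> sqrt (2 * lam * energy 0)"
proof (induction k)
  case 0
  then show ?case using z_hat_dist_le[of 0] by (simp add: z_hat_def)
next
  case (Suc k)
  have w: "0 \<le> \<tau> / weight k" "0 \<le> 1 - \<tau> / weight k"
    using \<tau> weight_ge_1[of k] by (auto simp: field_simps)
  have "convex (cball zs (sqrt (2 * lam * energy 0)))" by simp
  moreover have "z k \<in> cball zs (sqrt (2 * lam * energy 0))"
    "z_hat (Suc k) \<in> cball zs (sqrt (2 * lam * energy 0))"
    using Suc z_hat_dist_le[of "Suc k"] by (auto simp: dist_norm norm_minus_commute)
  ultimately have "z (Suc k) \<in> cball zs (sqrt (2 * lam * energy 0))"
    unfolding z_Suc_convex_combination using w by (intro convexD) auto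
  then show ?case by (simp add: dist_norm norm_minus_commute)
qed

lemma weighted_residual_le:
  "weight k * norm (residual (Suc k)) \<le> 2 * sqrt (2 * energy 0 / lam)"
proof -
  have "z k - z_hat (Suc k) = (lam * weight k) *\<^sub>R residual (Suc k)"
    by (simp add: z_hat_def)
  then have "lam * (weight k * norm (residual (Suc k))) = norm ((z k - zs) - (z_hat (Suc k) - zs))"
    using lam weight_ge_1[of k] by simp
  also have "\<dots> \<le> 2 * sqrt (2 * lam * energy 0)"
    using norm_triangle_ineq4[of "z k - zs" "z_hat (Suc k) - zs"] z_dist_le[of k]
      z_hat_dist_le[of "Suc k"] by linarith
  also have "sqrt (2 * lam * energy 0) = lam * sqrt (2 * energy 0 / lam)"
  proof -
    have "2 * lam * energy 0 = lam\<^sup>2 * (2 * energy 0 / lam)"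
      using lam by (simp add: power2_eq_square)
    then show ?thesis
      using lam by (simp only: real_sqrt_mult real_sqrt_abs abs_of_pos)
  qed
  finally show ?thesis using lam by simp
qed

text \<open>
  The left-hand side is the root of a sum of four squares, hence at most the sum of the four terms.
\<close>

lemma sqrt_energy_0_le:
  "sqrt (2 * energy 0 / lam) \<le> 2 / lam * norm (z 0 - zs) + norm (B (y 0) - B ys)
      + 1 / sqrt lam * op_norm S (x 0 - xs) + 1 / sqrt lam * op_norm T (y 0 - ys)"
proof -
  define p q r s where "p = 1 / lam * norm (z 0 - zs)" and "q = norm (B (y 0) - B ys)"
    and "r = 1 / sqrt lam * op_norm S (x 0 - xs)" and "s = 1 / sqrt lam * op_norm T (y 0 - ys)"
  have nn: "0 \<le> p" "0 \<le> q" "0 \<le> r" "0 \<le> s"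
    using lam S T by (auto simp: p_def q_def r_def s_def op_norm_def psd_operator_def)
  have "2 * energy 0 / lam = p\<^sup>2 + q\<^sup>2 + r\<^sup>2 + s\<^sup>2"
    using lam by (simp add: energy_0 p_def q_def r_def s_def power_mult_distrib power_divide
        field_simps power2_eq_square[of lam])
  also have "\<dots> \<le> (p + q + r + s)\<^sup>2"
    using nn by (simp add: power2_eq_square algebra_simps)
  finally have "sqrt (2 * energy 0 / lam) \<le> p + q + r + s"
    using nn by (intro real_le_lsqrt) auto
  also have "\<dots> \<le> 2 * p + q + r + s" using nn by simp
  finally show ?thesis by (simp add: p_def q_def r_def s_def)
qed

end

theorem corollary1:
  fixes f :: "'a::euclidean_space \<Rightarrow> ereal"
    and g :: "'b::euclidean_space \<Rightarrow> ereal"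
    and A :: "'a \<Rightarrow> 'c::euclidean_space"
    and B :: "'b \<Rightarrow> 'c"
    and c :: 'c
    and Sigf S :: "'a \<Rightarrow> 'a"
    and Sigg T :: "'b \<Rightarrow> 'b"
    and lam \<tau> C5 C6 :: real
    and x :: "nat \<Rightarrow> 'a" and y :: "nat \<Rightarrow> 'b" and z :: "nat \<Rightarrow> 'c"
    and xs :: 'a and ys :: 'b and zs :: 'c
  assumes f: "closed_proper_convex f" and g: "closed_proper_convex g"
    and A: "linear A" and B: "linear B"
    and Sigf: "convexity_operator f Sigf" and Sigg: "convexity_operator g Sigg"
    and lam: "lam > 0" and \<tau>: "\<tau> \<in> {0<..<1}"
    and S: "psd_operator S" and T: "psd_operator T"
    and pd_x: "pd_operator (\<lambda>u. Sigf u + S u + lam *\<^sub>R adjoint A (A u))"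
    and pd_y: "pd_operator (\<lambda>u. Sigg u + T u + lam *\<^sub>R adjoint B (B u))"
    and kkt: "kkt_solution f g A B c xs ys zs"
    and iter: "aspadmm f g A B c lam \<tau> S T x y z"
    and C5: "C5 = 2 / lam * norm (z 0 - zs) + norm (B (y 0) - B ys)
                  + 1 / sqrt lam * op_norm S (x 0 - xs) + 1 / sqrt lam * op_norm T (y 0 - ys)"
    and C6: "C6 = 1 / (2 * lam) * (norm (z 0 - zs))\<^sup>2 + lam / 2 * (norm (B (y 0) - B ys))\<^sup>2
                  + 1 / 2 * ((op_norm S (x 0 - xs))\<^sup>2 + (op_norm T (y 0 - ys))\<^sup>2)"
  shows "\<forall>K.
      ereal (- (2 * C5 * norm zs / (1 + real K * (1 - \<tau>))))
        \<le> f (x (Suc K)) + g (y (Suc K)) - f xs - g ys \<and>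
      f (x (Suc K)) + g (y (Suc K)) - f xs - g ys
        \<le> ereal ((2 * C5 * norm zs + C6) / (1 + real K * (1 - \<tau>))) \<and>
      0 \<le> norm (c - A (x (Suc K)) - B (y (Suc K))) \<and>
      norm (c - A (x (Suc K)) - B (y (Suc K))) \<le> 2 * C5 / (1 + real K * (1 - \<tau>))"
proof
  fix K
  interpret aspadmm_run f g A B c lam \<tau> S T x y z xs ys zs
    using f g A B lam \<tau> S T kkt iter by (auto intro: aspadmm_run.intro)
  define w where "w = 1 + real K * (1 - \<tau>)"
  define R where "R = norm (residual (Suc K))"
  define G where "G = objective_gap (Suc K)"
  have w: "weight K = w" "1 \<le> w"
    using weight_ge_1[of K] by (auto simp: w_def weight_def)
  have res: "norm (c - A (x (Suc K)) - B (y (Suc K))) = R"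
    by (simp add: R_def residual_def norm_minus_commute diff_diff_eq)
  have gap: "f (x (Suc K)) + g (y (Suc K)) - f xs - g ys = ereal G"
    by (subst f_x_Suc_finite, subst g_y_Suc_finite, subst f_xs_finite, subst g_ys_finite)
      (simp add: G_def objective_gap_def)
  have C6': "energy 0 = C6" by (simp add: energy_0 C6)
  have "sqrt (2 * energy 0 / lam) \<le> C5"
    using sqrt_energy_0_le unfolding C5 .
  then have R: "w * R \<le> 2 * C5"
    using weighted_residual_le[of K] unfolding w R_def by linarith
  then have R': "R \<le> 2 * C5 / w"
    using w by (simp add: field_simps)
  \<comment> \<open>The objective gap is the Lagrangian gap plus this inner product.\<close>
  have inner: "\<bar>zs \<bullet> residual (Suc K)\<bar> \<le> norm zs * R"
    unfolding R_def by (rule Cauchy_Schwarz_ineq2)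
  have wR: "w * (norm zs * R) \<le> 2 * C5 * norm zs"
    using mult_left_mono[OF R, of "norm zs"] by (simp add: algebra_simps)
  have "- (norm zs * R) \<le> G"
    using lagrangian_gap_Suc_nonneg[of K] inner by (simp add: lagrangian_gap_def G_def)
  then have "w * (- (norm zs * R)) \<le> w * G"
    using w by (intro mult_left_mono) auto
  then have lower: "- (2 * C5 * norm zs / w) \<le> G"
    using wR w by (simp add: field_simps)
  have "0 \<le> energy (Suc K)"
    using lam by (simp add: energy_def)
  then have "w * (G - zs \<bullet> residual (Suc K)) \<le> C6"
    using energy_bound[of K] by (simp add: w C6' lagrangian_gap_def G_def)
  moreover have "w * (zs \<bullet> residual (Suc K)) \<le> w * (norm zs * R)"
    using inner w by (intro mult_left_mono) auto
  ultimately have "w * G \<le> 2 * C5 * norm zs + C6"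
    using wR by (simp add: right_diff_distrib)
  then have upper: "G \<le> (2 * C5 * norm zs + C6) / w"
    using w by (simp add: field_simps)
  show "ereal (- (2 * C5 * norm zs / (1 + real K * (1 - \<tau>))))
        \<le> f (x (Suc K)) + g (y (Suc K)) - f xs - g ys \<and>
      f (x (Suc K)) + g (y (Suc K)) - f xs - g ys
        \<le> ereal ((2 * C5 * norm zs + C6) / (1 + real K * (1 - \<tau>))) \<and>
      0 \<le> norm (c - A (x (Suc K)) - B (y (Suc K))) \<and>
      norm (c - A (x (Suc K)) - B (y (Suc K))) \<le> 2 * C5 / (1 + real K * (1 - \<tau>))"
    unfolding gap res w_def[symmetric] using lower upper R' by (simp add: R_def)
qed

end
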